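(* Let $\mathcal X\subseteq[0,1]$ be a Borel set with $0,1\in\mathcal X$, fix $T\ge 1$ and $\mu\in(0,1)$, and let $I_\mu=[(\mu-1)^{-1},\mu^{-1}]$. Let $$\mathcal H^T_\mu=\big\{P\in\mathcal P_{\mathcal X^T}:\ \mathbb E_P[X_t\mid X^{t-1}]=\mu\ \ P\text{-a.s.},\ \forall t\in\{1,\dots,T\}\big\},$$ with the convention $\mathbb E_P[X_1\mid X^0]=\mathbb E_P[X_1]$. Let $\Lambda^T_\mu$ be the set of $T$-tuples $\lambda^T=(\lambda_1,\dots,\lambda_T)$ where each $\lambda_t:\mathcal X^{t-1}\to I_\mu$ is Borel (with $\lambda_1$ simply an element of $I_\mu$), and for $\lambda^T\in\Lambda^T_\mu$ let $E_{\lambda^T}(x^T)=\prod_{t=1}^T\big(1+\lambda_t(x^{t-1})(x_t-\mu)\big)$. Then the class $\mathcal E^{\mathrm{cb},T}_\mu=\{E_{\lambda^T}:\lambda^T\in\Lambda^T_\mu\}$ is the optimal e-class for $\mathcal H^T_\mu$.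
   Context: $\mathcal P_{\mathcal X^T}$ is the set of Borel probability measures on $\mathcal X^T$; $x^t=(x_1,\dots,x_t)$ and $X^t=(X_1,\dots,X_t)$ denotes the first $t$ coordinates. For a hypothesis $\mathcal H$ (non-empty set of Borel probability measures on a Borel set $\mathcal Z\subseteq\mathbb R^d$), an e-variable is a Borel $E:\mathcal Z\to[0,+\infty)$ with $\mathbb E_P[E]\le1$ for all $P\in\mathcal H$; $\mathcal E_{\mathcal H}$ is the set of all of them and an e-class is any subset of it. $f\succeq f'$ means $f\ge f'$ pointwise. An e-class $\mathcal E$ is majorising if for every $E'\in\mathcal E_{\mathcal H}$ there is $E\in\mathcal E$ with $E\succeq E'$. A majorising e-class is optimal if it is contained in every other majorising e-class. *)

theory Defs
  imports "HOL-Probability.Probability"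
begin

definition XT :: "real set \<Rightarrow> nat \<Rightarrow> (nat \<Rightarrow> real) measure" where
  "XT X T = PiM {..<T} (\<lambda>_. restrict_space borel X)"

definition filt :: "real set \<Rightarrow> nat \<Rightarrow> nat \<Rightarrow> (nat \<Rightarrow> real) measure" where
  "filt X T t = vimage_algebra (space (XT X T)) (\<lambda>x. restrict x {..<t}) (XT X t)"

text \<open>The hypothesis H^T_mu: E_P[X_t | X^{t-1}] = mu a.s. for all t (0-based: coordinate t
  given the first t coordinates; for t = 0 the conditioning sigma-algebra is trivial).\<close>
definition H_mu :: "real set \<Rightarrow> nat \<Rightarrow> real \<Rightarrow> (nat \<Rightarrow> real) measure set" where
  "H_mu X T \<mu> = {P. sets P = sets (XT X T) \<and> prob_space P \<and>
     (\<forall>t<T. AE x in P. real_cond_exp P (filt X T t) (\<lambda>x. x t) x = \<mu>)}"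

text \<open>E-variables for a hypothesis H on the sample space Z. Functions are normalised to be 0
  outside the sample space, so that classes of e-variables are sets of functions on Z.\<close>
definition evars :: "'a measure \<Rightarrow> 'a measure set \<Rightarrow> ('a \<Rightarrow> real) set" where
  "evars Z H = {E. E \<in> borel_measurable Z \<and> (\<forall>x\<in>space Z. 0 \<le> E x) \<and>
     (\<forall>x. x \<notin> space Z \<longrightarrow> E x = 0) \<and>
     (\<forall>P\<in>H. (\<integral>\<^sup>+ x. ennreal (E x) \<partial>P) \<le> 1)}"

definition e_class :: "'a measure \<Rightarrow> 'a measure set \<Rightarrow> ('a \<Rightarrow> real) set \<Rightarrow> bool" where
  "e_class Z H C \<longleftrightarrow> C \<subseteq> evars Z H"

definition majorising :: "'a measure \<Rightarrow> 'a measure set \<Rightarrow> ('a \<Rightarrow> real) set \<Rightarrow> bool" where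
  "majorising Z H C \<longleftrightarrow> e_class Z H C \<and>
     (\<forall>E'\<in>evars Z H. \<exists>E\<in>C. \<forall>x\<in>space Z. E' x \<le> E x)"

definition optimal_eclass :: "'a measure \<Rightarrow> 'a measure set \<Rightarrow> ('a \<Rightarrow> real) set \<Rightarrow> bool" where
  "optimal_eclass Z H C \<longleftrightarrow> majorising Z H C \<and> (\<forall>C'. majorising Z H C' \<longrightarrow> C \<subseteq> C')"

text \<open>Predictable bets: lam t is a Borel map X^t \<rightarrow> I_mu (0-based; lam 0 is defined on the
  one-point space X^0, i.e. a constant).\<close>
definition Lambda_mu :: "real set \<Rightarrow> nat \<Rightarrow> real \<Rightarrow> (nat \<Rightarrow> (nat \<Rightarrow> real) \<Rightarrow> real) set" where
  "Lambda_mu X T \<mu> = {lam. \<forall>t<T. lam t \<in> borel_measurable (XT X t) \<and>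
     (\<forall>y\<in>space (XT X t). lam t y \<in> {1 / (\<mu> - 1) .. 1 / \<mu>})}"

definition E_lam :: "real set \<Rightarrow> nat \<Rightarrow> real \<Rightarrow> (nat \<Rightarrow> (nat \<Rightarrow> real) \<Rightarrow> real) \<Rightarrow> (nat \<Rightarrow> real) \<Rightarrow> real" where
  "E_lam X T \<mu> lam = (\<lambda>x. if x \<in> space (XT X T)
     then (\<Prod>t<T. 1 + lam t (restrict x {..<t}) * (x t - \<mu>)) else 0)"

definition E_cb :: "real set \<Rightarrow> nat \<Rightarrow> real \<Rightarrow> ((nat \<Rightarrow> real) \<Rightarrow> real) set" where
  "E_cb X T \<mu> = E_lam X T \<mu> ` Lambda_mu X T \<mu>"

end

theory Submission
  imports Defs
begin

text \<open>
  Products of bets are e-variables because the capital process is a martingale under the hypothesis.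
  Conversely, let \<open>F\<^sub>t(x\<^sup>t)\<close> be the supremum of the conditional expectations of an e-variable \<open>E\<close> over the
  continuations of \<open>x\<^sup>t\<close> that branch into two outcomes on either side of \<open>\<mu>\<close> at each step.
  Then \<open>F\<^sub>0 \<le> 1\<close>, and \<open>F\<^sub>t\<close> dominates the two-point means of \<open>F\<^sub>t\<^sub>+\<^sub>1\<close>, so that at every path there is
  an affine function through \<open>(\<mu>, F\<^sub>t)\<close> above \<open>F\<^sub>t\<^sub>+\<^sub>1\<close>; its slope gives the bet. The functions \<open>F\<^sub>t\<close> are only upper
  semianalytic. Working forward in time with the Borel capital process in place of \<open>F\<^sub>t\<close>, the lower
  and upper bounds on the next bet have analytic level sets, which Lusin's separation theorem
  separates by Borel sets; this yields a Borel bet. Finally, no member of the class strictly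
  dominates another, since an affine function of the next outcome that vanishes at \<open>\<mu>\<close> and is
  nonnegative at 0 and 1 is zero.
\<close>

subsection \<open>Analytic sets and Lusin separation\<close>

text \<open>Witnesses are real sequences rather than elements of Baire space: a quantifier over
  reals can then be absorbed as one more coordinate of the witness. On Polish spaces these are the
  usual analytic sets.\<close>

definition analytic :: "'a::topological_space set \<Rightarrow> bool" where
  "analytic A \<longleftrightarrow> (\<exists>C::('a \<times> (nat \<Rightarrow> real)) set. closed C \<and> A = fst ` C)"

lemma analytic_iff:
  "analytic A \<longleftrightarrow> (\<exists>C. closed C \<and> (\<forall>x. x \<in> A \<longleftrightarrow> (\<exists>w::nat \<Rightarrow> real. (x, w) \<in> C)))"
  unfolding analytic_def by (intro ex_cong1 conj_cong refl) (force simp: image_iff set_eq_iff)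

lemma continuous_on_snd_coordinate [continuous_intros]:
  shows "continuous_on S (\<lambda>p::'a::topological_space \<times> ('b \<Rightarrow> 'c::topological_space). snd p i)"
  by (rule continuous_on_product_then_coordinatewise) (intro continuous_intros)

lemma closed_Collect_mem:
  assumes "closed C" "continuous_on UNIV f"
  shows "closed {x. f x \<in> C}"
  using closed_vimage[OF assms] by (simp add: vimage_def)

lemma analytic_closed:
  assumes "closed A"
  shows "analytic A"
  unfolding analytic_iff
  by (rule exI[of _ "{p. fst p \<in> A}"])
     (auto intro!: closed_Collect_mem assms continuous_intros)

lemma analytic_vimage:
  fixes f :: "'a::topological_space \<Rightarrow> 'b::topological_space"
  assumes "analytic A" "continuous_on UNIV f"
  shows "analytic {x. f x \<in> A}"
proof -
  obtain C where C: "closed C" "\<And>x. x \<in> A \<longleftrightarrow> (\<exists>w::nat \<Rightarrow> real. (x, w) \<in> C)"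
    using assms(1) unfolding analytic_iff by blast
  have "continuous_on UNIV (\<lambda>p::'a \<times> (nat \<Rightarrow> real). f (fst p))"
    by (rule continuous_on_compose2[OF assms(2)]) (auto intro!: continuous_intros)
  then have "closed {p. (f (fst p), snd p) \<in> C}"
    by (intro closed_Collect_mem C continuous_intros)
  then show ?thesis unfolding analytic_iff using C(2)
    by (intro exI[of _ "{p. (f (fst p), snd p) \<in> C}"]) auto
qed

lemma analytic_UN:
  assumes "\<And>n::nat. analytic (A n)"
  shows "analytic (\<Union>n. A n)"
proof -
  have "\<forall>n. \<exists>C. closed C \<and> (\<forall>x. x \<in> A n \<longleftrightarrow> (\<exists>w::nat \<Rightarrow> real. (x, w) \<in> C))"
    using assms unfolding analytic_iff by blast
  then obtain C where C: "\<And>n. closed (C n)"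
      "\<And>n x. x \<in> A n \<longleftrightarrow> (\<exists>w::nat \<Rightarrow> real. (x, w) \<in> C n)"
    by metis
  \<comment> \<open>The witness starts with the index of the set; it is read off by a closed condition.\<close>
  define D :: "('a \<times> (nat \<Rightarrow> real)) set" where
    "D = {p. snd p 0 \<in> \<nat>} \<inter> (\<Inter>n. {p. 1 / 2 \<le> \<bar>snd p 0 - real n\<bar>} \<union> {p. (fst p, \<lambda>i. snd p (Suc i)) \<in> C n})"
  have "closed D" unfolding D_def
    by (intro closed_Int closed_INT ballI closed_Un closed_Collect_mem closed_Collect_le C continuous_intros)
       auto
  moreover have "x \<in> (\<Union>n. A n) \<longleftrightarrow> (\<exists>w. (x, w) \<in> D)" for x
  proof
    assume "x \<in> (\<Union>n. A n)"
    then obtain n w where w: "(x, w) \<in> C n" using C(2) by blast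
    have "1 / 2 \<le> \<bar>real n - real m\<bar> \<or> m = n" for m by linarith
    then have "(x, case_nat (real n) w) \<in> D" using w by (auto simp: D_def)
    then show "\<exists>w. (x, w) \<in> D" by blast
  next
    assume "\<exists>w. (x, w) \<in> D"
    then obtain w where w: "(x, w) \<in> D" by blast
    then obtain n where n: "w 0 = real n" by (auto simp: D_def elim: Nats_cases)
    with w have "(x, \<lambda>i. w (Suc i)) \<in> C n" by (auto simp: D_def dest: spec[of _ n])
    then show "x \<in> (\<Union>n. A n)" using C(2) by blast
  qed
  ultimately show ?thesis unfolding analytic_iff by blast
qed

text \<open>A point of the intersection has a witness for each \<open>A n\<close>;
  \<open>prod_encode\<close> interleaves these countably many sequences into one.\<close>

lemma analytic_INT:
  assumes "\<And>n::nat. analytic (A n)"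
  shows "analytic (\<Inter>n. A n)"
proof -
  have "\<forall>n. \<exists>C. closed C \<and> (\<forall>x. x \<in> A n \<longleftrightarrow> (\<exists>w::nat \<Rightarrow> real. (x, w) \<in> C))"
    using assms unfolding analytic_iff by blast
  then obtain C where C: "\<And>n. closed (C n)"
      "\<And>n x. x \<in> A n \<longleftrightarrow> (\<exists>w::nat \<Rightarrow> real. (x, w) \<in> C n)"
    by metis
  define D :: "('a \<times> (nat \<Rightarrow> real)) set" where
    "D = (\<Inter>n. {p. (fst p, \<lambda>i. snd p (prod_encode (n, i))) \<in> C n})"
  have "closed D" unfolding D_def
    by (intro closed_INT ballI closed_Collect_mem C continuous_intros)
  moreover have "x \<in> (\<Inter>n. A n) \<longleftrightarrow> (\<exists>w. (x, w) \<in> D)" for x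
  proof
    assume "x \<in> (\<Inter>n. A n)"
    then obtain w where w: "\<And>n. (x, w n) \<in> C n" using C(2) by (metis INT_iff UNIV_I)
    then have "(x, \<lambda>j. w (fst (prod_decode j)) (snd (prod_decode j))) \<in> D" by (simp add: D_def)
    then show "\<exists>w. (x, w) \<in> D" by blast
  qed (auto simp: D_def C(2))
  ultimately show ?thesis unfolding analytic_iff by blast
qed

lemma analytic_Int:
  assumes "analytic A" "analytic B"
  shows "analytic (A \<inter> B)"
proof -
  have "A \<inter> B = (\<Inter>n::nat. if n = 0 then A else B)" by (auto split: if_splits)
  then show ?thesis using analytic_INT[of "\<lambda>n. if n = 0 then A else B"] assms by simp
qed

text \<open>The projected real is stored as entry 0 of the witness and the old witness is shifted by
  one.\<close>

lemma analytic_project: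
  fixes A :: "('a::topological_space \<times> real) set"
  assumes "analytic A"
  shows "analytic {x. \<exists>b. (x, b) \<in> A}"
proof -
  obtain C where C: "closed C" "\<And>x. x \<in> A \<longleftrightarrow> (\<exists>w::nat \<Rightarrow> real. (x, w) \<in> C)"
    using assms unfolding analytic_iff by blast
  have "closed {p. ((fst p, snd p 0), \<lambda>i. snd p (Suc i)) \<in> C}"
    by (intro closed_Collect_mem C continuous_intros)
  moreover have "(\<exists>b. (x, b) \<in> A) \<longleftrightarrow> (\<exists>w. ((x, w 0), \<lambda>i. w (Suc i)) \<in> C)" for x
  proof
    assume "\<exists>b. (x, b) \<in> A"
    then obtain b w where "((x, b), w) \<in> C" using C(2) by blast
    then show "\<exists>w. ((x, w 0), \<lambda>i. w (Suc i)) \<in> C" by (intro exI[of _ "case_nat b w"]) simp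
  qed (use C(2) in blast)
  ultimately show ?thesis unfolding analytic_iff
    by (intro exI[of _ "{p. ((fst p, snd p 0), \<lambda>i. snd p (Suc i)) \<in> C}"]) simp
qed

lemma analytic_open:
  fixes U :: "'a::metric_space set"
  assumes "open U"
  shows "analytic U"
\<comment> \<open>\<open>infdist\<close> to the empty set is 0 by convention, so an empty complement
  is treated separately.\<close>
proof (cases "U = UNIV")
  case False
  define F where "F n = {x. inverse (real (Suc n)) \<le> infdist x (- U)}" for n
  have "closed (F n)" for n unfolding F_def
    by (intro closed_Collect_le continuous_intros)
  moreover have "U = (\<Union>n. F n)"
  proof (intro set_eqI iffI)
    fix x assume "x \<in> U"
    then have "infdist x (- U) \<noteq> 0"
      using in_closed_iff_infdist_zero[of "- U" x] assms False by auto
    then have "0 < infdist x (- U)" using infdist_nonneg[of x "- U"] by linarith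
    then obtain n where "inverse (real (Suc n)) < infdist x (- U)" using reals_Archimedean by blast
    then show "x \<in> (\<Union>n. F n)" by (auto simp: F_def intro!: exI[of _ n])
  next
    fix x assume "x \<in> (\<Union>n. F n)"
    then obtain n where "inverse (real (Suc n)) \<le> infdist x (- U)" by (auto simp: F_def)
    then have "0 < infdist x (- U)" by (rule less_le_trans[rotated]) simp
    then have "x \<notin> - U" using infdist_zero[of x "- U"] by force
    then show "x \<in> U" by simp
  qed
  ultimately show ?thesis by (metis analytic_UN analytic_closed)
qed (simp add: analytic_closed)

lemma analytic_borel:
  fixes A :: "'a::metric_space set"
  assumes "A \<in> sets borel"
  shows "analytic A"
proof -
  have "A \<in> sigma_sets UNIV {S. open S}" using assms by (simp add: borel_def)
  \<comment> \<open>Analyticity is not preserved by complements, so the induction carries a set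
    together with its complement.\<close>
  then have "analytic A \<and> analytic (- A)"
  proof induction
    case (Compl a)
    then show ?case by (auto simp: Compl_eq_Diff_UNIV[symmetric])
  next
    case (Union a)
    then show ?case by (auto intro: analytic_UN analytic_INT)
  qed (auto intro: analytic_open analytic_closed)
  then show ?thesis ..
qed

section \<open>Separation of disjoint analytic sets by Borel sets\<close>

definition borel_separable :: "'a::topological_space set \<Rightarrow> 'a set \<Rightarrow> bool" where
  "borel_separable A B \<longleftrightarrow> (\<exists>D\<in>sets borel. A \<subseteq> D \<and> B \<inter> D = {})"

text \<open>Applied contrapositively: when both sides of a nonseparable pair are cut into countably
  many pieces, some pair of pieces is nonseparable. The separator is the union over \<open>m\<close>
  of the intersections over \<open>n\<close> of the \<open>D m n\<close>.\<close>

lemma borel_separable_UN: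
  fixes A B :: "nat \<Rightarrow> 'a::topological_space set"
  assumes "\<And>m n. borel_separable (A m) (B n)"
  shows "borel_separable (\<Union>m. A m) (\<Union>n. B n)"
proof -
  obtain D where D: "\<And>m n. D m n \<in> sets borel" "\<And>m n. A m \<subseteq> D m n" "\<And>m n. B n \<inter> D m n = {}"
    using assms unfolding borel_separable_def by metis
  have "(\<Union>m. \<Inter>n. D m n) \<in> sets borel"
    using D(1) by (auto intro!: sets.countable_UN sets.countable_INT)
  moreover have "(\<Union>m. A m) \<subseteq> (\<Union>m. \<Inter>n. D m n)" using D(2) by blast
  moreover have "(\<Union>n. B n) \<inter> (\<Union>m. \<Inter>n. D m n) = {}" using D(3) by blast
  ultimately show ?thesis unfolding borel_separable_def by blast
qed

lemma countable_cball_cover: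
  fixes e :: real
  assumes "0 < e"
  shows "\<exists>c::nat \<Rightarrow> 'a::{metric_space, second_countable_topology}. (\<Union>n. cball (c n) e) = UNIV"
proof -
  obtain D :: "'a set" where D: "countable D" "\<And>X. open X \<Longrightarrow> X \<noteq> {} \<Longrightarrow> \<exists>d\<in>D. d \<in> X"
    using countable_dense_setE by blast
  have "D \<noteq> {}" using D(2)[of UNIV] by auto
  have "\<exists>n. x \<in> cball (from_nat_into D n) e" for x
  proof -
    obtain d where "d \<in> D" "d \<in> ball x e" using D(2)[of "ball x e"] assms by auto
    then show ?thesis using from_nat_into_surj[OF D(1)]
      by (metis dist_commute less_eq_real_def mem_ball mem_cball)
  qed
  then show ?thesis by (intro exI[of _ "from_nat_into D"]) blast
qed

text \<open>If separation failed, cutting both sides by small balls would give a decreasing sequence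
  of pairs of closed sets with nonseparable images. By completeness the two sides shrink to points
  \<open>a\<close> and \<open>b\<close>. Their images differ, and disjoint open neighbourhoods of
  these images separate a late pair, a contradiction.\<close>

lemma borel_separable_continuous_images:
  fixes f :: "'p::{complete_space, second_countable_topology} \<Rightarrow> 'a::t2_space"
  assumes f: "continuous_on UNIV f" and "closed C" "closed D" and disj: "f ` C \<inter> f ` D = {}"
  shows "borel_separable (f ` C) (f ` D)"
proof (rule ccontr)
  assume notsep: "\<not> ?thesis"
  define Q where "Q n Z \<longleftrightarrow> closed (fst Z) \<and> closed (snd Z) \<and> fst Z \<subseteq> C \<and> snd Z \<subseteq> D \<and>
    \<not> borel_separable (f ` fst Z) (f ` snd Z)" for n :: nat and Z :: "'p set \<times> 'p set"
  \<comment> \<open>Piece \<open>n + 1\<close> lies in a ball of radius \<open>1 / (n + 1)\<close>;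
    the initial pair \<open>(C, D)\<close> carries no size bound.\<close>
  define R where "R n Y Z \<longleftrightarrow> fst Z \<subseteq> fst Y \<and> snd Z \<subseteq> snd Y \<and>
    (\<exists>c. fst Z \<subseteq> cball c (inverse (real (Suc n)))) \<and> (\<exists>d. snd Z \<subseteq> cball d (inverse (real (Suc n))))"
    for n :: nat and Y Z :: "'p set \<times> 'p set"
  have "\<exists>Z. Q (Suc n) Z \<and> R n Y Z" if "Q n Y" for n Y
  proof -
    obtain c :: "nat \<Rightarrow> 'p" where c: "(\<Union>k. cball (c k) (inverse (real (Suc n)))) = UNIV"
      using countable_cball_cover[of "inverse (real (Suc n))"] by auto
    have cover: "f ` Z = (\<Union>k. f ` (Z \<inter> cball (c k) (inverse (real (Suc n)))))" for Z
      using c by blast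
    have "\<exists>k l. \<not> borel_separable (f ` (fst Y \<inter> cball (c k) (inverse (real (Suc n)))))
        (f ` (snd Y \<inter> cball (c l) (inverse (real (Suc n)))))"
    proof (rule ccontr)
      assume "\<not> ?thesis"
      then have "borel_separable (f ` fst Y) (f ` snd Y)"
        unfolding cover[of "fst Y"] cover[of "snd Y"] by (intro borel_separable_UN) simp
      then show False using \<open>Q n Y\<close> by (simp add: Q_def)
    qed
    then obtain k l where "\<not> borel_separable (f ` (fst Y \<inter> cball (c k) (inverse (real (Suc n)))))
        (f ` (snd Y \<inter> cball (c l) (inverse (real (Suc n)))))" by blast
    then show ?thesis using \<open>Q n Y\<close>
      by (intro exI[of _ "(fst Y \<inter> cball (c k) (inverse (real (Suc n))), snd Y \<inter> cball (c l) (inverse (real (Suc n))))"])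
         (auto simp: Q_def R_def)
  qed
  moreover have "Q 0 (C, D)" using notsep assms by (simp add: Q_def)
  ultimately obtain Z where Z: "\<And>n. Q n (Z n)" "\<And>n. R n (Z n) (Z (Suc n))"
    using dependent_nat_choice[of Q R] by blast
  have small: "\<exists>n. \<forall>x\<in>S n. \<forall>y\<in>S n. dist x y < e"
    if S: "\<And>n. \<exists>c. S (Suc n) \<subseteq> cball c (inverse (real (Suc n)))" and "0 < e" for S :: "nat \<Rightarrow> 'p set" and e
  proof -
    obtain n where n: "inverse (real (Suc n)) < e / 2" using reals_Archimedean[of "e / 2"] \<open>0 < e\<close> by auto
    obtain c where c: "S (Suc n) \<subseteq> cball c (inverse (real (Suc n)))" using S by blast
    have "dist x y < e" if "x \<in> S (Suc n)" "y \<in> S (Suc n)" for x y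
    proof -
      have "dist x c < e / 2" "dist y c < e / 2" using that c n by (auto simp: dist_commute)
      then show ?thesis by (rule dist_triangle_half_r[of c, unfolded dist_commute[of c]])
    qed
    then show ?thesis by blast
  qed
  have nested: "\<exists>a. (\<forall>n. a \<in> S n) \<and> (\<forall>V. open V \<longrightarrow> a \<in> V \<longrightarrow> (\<exists>n. S n \<subseteq> V))"
    if S: "\<And>n. closed (S n)" "\<And>n. S n \<noteq> {}" "\<And>n. S (Suc n) \<subseteq> S n"
      "\<And>n. \<exists>c. S (Suc n) \<subseteq> cball c (inverse (real (Suc n)))" for S :: "nat \<Rightarrow> 'p set"
  proof -
    have "S n \<subseteq> S m" if "m \<le> n" for m n using lift_Suc_antimono_le[of S, OF S(3) that] .
    from decreasing_closed_nest[OF S(1,2) this small[OF S(4)]]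
    obtain a where a: "\<And>n. a \<in> S n" by metis
    have "\<exists>n. S n \<subseteq> V" if V: "open V" "a \<in> V" for V
    proof -
      obtain e where "0 < e" "ball a e \<subseteq> V" using V open_contains_ball by blast
      moreover obtain n where "\<forall>x\<in>S n. \<forall>y\<in>S n. dist x y < e" using small[OF S(4) \<open>0 < e\<close>] by blast
      ultimately show ?thesis using a by (auto simp: subset_eq intro!: exI[of _ n])
    qed
    then show ?thesis using a by blast
  qed
  \<comment> \<open>A pair with an empty side is separated by \<open>{}\<close> or by
    \<open>UNIV\<close>.\<close>
  have ne: "fst (Z n) \<noteq> {}" "snd (Z n) \<noteq> {}" for n
    using Z(1)[of n] unfolding Q_def borel_separable_def
    by (auto intro: bexI[of _ "{}"] dest: bspec[of _ _ UNIV])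
  obtain a where a: "\<And>n. a \<in> fst (Z n)" "\<And>V. open V \<Longrightarrow> a \<in> V \<Longrightarrow> \<exists>n. fst (Z n) \<subseteq> V"
    using nested[of "\<lambda>n. fst (Z n)"] Z ne unfolding Q_def R_def by blast
  obtain b where b: "\<And>n. b \<in> snd (Z n)" "\<And>V. open V \<Longrightarrow> b \<in> V \<Longrightarrow> \<exists>n. snd (Z n) \<subseteq> V"
    using nested[of "\<lambda>n. snd (Z n)"] Z ne unfolding Q_def R_def by blast
  have "f a \<noteq> f b" using a(1) b(1) Z(1) disj unfolding Q_def by blast
  then obtain U V where UV: "open U" "open V" "f a \<in> U" "f b \<in> V" "U \<inter> V = {}" by (metis hausdorff)
  obtain m where m: "fst (Z m) \<subseteq> f -` U"
    using a(2)[of "f -` U"] UV open_vimage[OF UV(1) f] by auto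
  obtain n where n: "snd (Z n) \<subseteq> f -` V"
    using b(2)[of "f -` V"] UV open_vimage[OF UV(2) f] by auto
  have anti: "fst (Z j) \<subseteq> fst (Z i)" "snd (Z j) \<subseteq> snd (Z i)" if "i \<le> j" for i j
    using Z(2) that lift_Suc_antimono_le[of "\<lambda>n. fst (Z n)"] lift_Suc_antimono_le[of "\<lambda>n. snd (Z n)"]
    unfolding R_def by blast+
  have "f ` fst (Z (max m n)) \<subseteq> U" "f ` snd (Z (max m n)) \<inter> U = {}"
    using m n anti[of m "max m n"] anti[of n "max m n"] UV(5) by auto
  then have "borel_separable (f ` fst (Z (max m n))) (f ` snd (Z (max m n)))"
    unfolding borel_separable_def using UV(1) by (intro bexI[of _ U]) auto
  then show False using Z(1) unfolding Q_def by blast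
qed

lemma lusin_separation:
  fixes A B :: "'a::{complete_space, second_countable_topology} set"
  assumes "analytic A" "analytic B" "A \<inter> B = {}"
  shows "\<exists>D\<in>sets borel. A \<subseteq> D \<and> B \<inter> D = {}"
proof -
  obtain C D :: "('a \<times> (nat \<Rightarrow> real)) set" where CD: "closed C" "A = fst ` C" "closed D" "B = fst ` D"
    using assms(1,2) unfolding analytic_def by blast
  have "borel_separable (fst ` C) (fst ` D)"
    by (rule borel_separable_continuous_images) (use CD assms in \<open>auto intro!: continuous_intros\<close>)
  then show ?thesis using CD unfolding borel_separable_def by simp
qed

text \<open>\<open>A r\<close> is to be read as "\<open>r\<close> is too small at \<open>x\<close>"
  and \<open>B r\<close> as "\<open>r\<close> is too large at \<open>x\<close>". A Borel separator
  is chosen for each rational, and \<open>f x\<close> is the supremum of the rationals whose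
  separator contains \<open>x\<close>. The hypotheses \<open>low\<close> and \<open>high\<close>
  make this supremum finite and place it in \<open>[l, u]\<close>.\<close>

lemma borel_insertion:
  fixes A B :: "rat \<Rightarrow> 'a::{complete_space, second_countable_topology} set" and l u :: real
  assumes W: "W \<in> sets borel"
    and an: "\<And>r. analytic (A r)" "\<And>r. analytic (B r)"
    and disj: "\<And>r. A r \<inter> B r = {}"
    and mono: "\<And>r s. r \<le> s \<Longrightarrow> B r \<subseteq> B s"
    and low: "\<And>r x. x \<in> W \<Longrightarrow> of_rat r < l \<Longrightarrow> x \<in> A r"
    and high: "\<And>r x. x \<in> W \<Longrightarrow> u < of_rat r \<Longrightarrow> x \<in> B r"
  shows "\<exists>f\<in>borel_measurable borel.
    (\<forall>x\<in>W. (\<forall>r. x \<in> A r \<longrightarrow> of_rat r \<le> f x) \<and> (\<forall>r. x \<in> B r \<longrightarrow> f x \<le> of_rat r) \<and> l \<le> f x \<and> f x \<le> u) \<and>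
    (\<forall>x. x \<notin> W \<longrightarrow> f x = l)"
proof -
  obtain D where D: "\<And>r. D r \<in> sets borel" "\<And>r. A r \<subseteq> D r" "\<And>r. B r \<inter> D r = {}"
    using lusin_separation[OF an disj] by metis
  define R :: "'a \<Rightarrow> real set" where "R x = {of_rat r | r. x \<in> D r}" for x
  define f where "f x = (if x \<in> W then Sup (R x) else l)" for x
  \<comment> \<open>The sets \<open>D r\<close> are chosen independently and may fail to decrease in
    \<open>r\<close>; monotonicity of \<open>B\<close> still shows that no rational from
    \<open>r\<close> on enters \<open>R x\<close> once \<open>x\<close> lies in
    \<open>B r\<close>.\<close>
  have bound: "s \<le> of_rat r" if "x \<in> B r" "s \<in> R x" for x r s
  proof -
    obtain q where q: "s = of_rat q" "x \<in> D q" using \<open>s \<in> R x\<close> unfolding R_def by blast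
    have "\<not> r \<le> q" using mono[of r q] \<open>x \<in> B r\<close> D(3) q(2) by blast
    then show ?thesis using q by (simp add: of_rat_less_eq)
  qed
  have ne: "R x \<noteq> {}" if "x \<in> W" for x
  proof -
    obtain r where "of_rat r < l" using of_rat_dense[of "l - 1" l] by auto
    then show ?thesis using low[OF that] D(2) by (auto simp: R_def)
  qed
  have bdd: "bdd_above (R x)" if "x \<in> W" for x
  proof -
    obtain r where "u < of_rat r" using of_rat_dense[of u "u + 1"] by auto
    then show ?thesis using high[OF that] bound by (intro bdd_aboveI) blast
  qed
  have fA: "of_rat r \<le> f x" if "x \<in> W" "x \<in> A r" for x r
    using that D(2) bdd by (auto simp: f_def R_def intro!: cSup_upper)
  have fB: "f x \<le> of_rat r" if "x \<in> W" "x \<in> B r" for x r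
    using that ne bound by (auto simp: f_def intro!: cSup_least)
  have "l \<le> f x" if "x \<in> W" for x
  proof (rule ccontr)
    assume "\<not> l \<le> f x"
    then obtain r where "f x < of_rat r" "of_rat r < l" using of_rat_dense[of "f x" l] by auto
    then show False using fA[OF that low[OF that]] by fastforce
  qed
  moreover have "f x \<le> u" if "x \<in> W" for x
  proof (rule ccontr)
    assume "\<not> f x \<le> u"
    then obtain r where "u < of_rat r" "of_rat r < f x" using of_rat_dense[of u "f x"] by auto
    then show False using fB[OF that high[OF that]] by fastforce
  qed
  moreover have "f \<in> borel_measurable borel"
  proof (rule borel_measurableI_greater)
    fix c :: real
    have "{x. c < f x} = {x \<in> - W. c < l} \<union> (W \<inter> (\<Union>r\<in>{r. c < of_rat r}. D r))"
      using ne bdd by (auto simp: f_def less_cSup_iff R_def)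
    also have "\<dots> \<in> sets borel" using W D(1)
      by (intro sets.Un sets.Int sets.countable_UN') (auto simp: Compl_in_sets_lebesgue)
    finally show "{x \<in> space borel. c < f x} \<in> sets borel" by simp
  qed
  moreover have "f x = l" if "x \<notin> W" for x using that by (simp add: f_def)
  ultimately show ?thesis using fA fB by (intro bexI[of _ f] conjI ballI allI impI) auto
qed

lemma analytic_conj:
  assumes "analytic {x. P x}" "analytic {x. Q x}"
  shows "analytic {x. P x \<and> Q x}"
  using analytic_Int[OF assms] by (simp add: Collect_conj_eq)

lemma analytic_ex:
  fixes P :: "'a::topological_space \<Rightarrow> real \<Rightarrow> bool"
  assumes "analytic {p. P (fst p) (snd p)}"
  shows "analytic {x. \<exists>b. P x b}"
  using analytic_project[OF assms] by simp

lemma analytic_less: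
  fixes f g :: "'a::metric_space \<Rightarrow> real"
  assumes "f \<in> borel_measurable borel" "g \<in> borel_measurable borel"
  shows "analytic {x. f x < g x}"
  using analytic_borel[of "{x. f x < g x}"] borel_measurable_less[OF assms] by simp

lemma continuous_on_fun_upd [continuous_intros]:
  fixes f :: "'a::topological_space \<Rightarrow> 'b \<Rightarrow> 'c::topological_space"
  assumes "continuous_on S f" "continuous_on S g"
  shows "continuous_on S (\<lambda>x. (f x)(k := g x))"
proof (rule continuous_on_coordinatewise_then_product)
  show "continuous_on S (\<lambda>x. ((f x)(k := g x)) i)" for i
    using assms(2) continuous_on_product_then_coordinatewise[OF assms(1)] by (cases "i = k") auto
qed

subsection \<open>Paths and capital processes\<close>

locale bounded_mean =
  fixes X :: "real set" and \<mu> :: real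
  assumes X_borel: "X \<in> sets borel" and X_unit: "X \<subseteq> {0..1}" and zero_X: "0 \<in> X" and one_X: "1 \<in> X"
    and mu_pos: "0 < \<mu>" and mu_less: "\<mu> < 1"
begin

abbreviation paths :: "nat \<Rightarrow> (nat \<Rightarrow> real) set" where
  "paths t \<equiv> space (XT X t)"

lemma paths_eq: "paths t = (\<Pi>\<^sub>E i\<in>{..<t}. X)"
  by (simp add: XT_def space_PiM space_restrict_space)

lemma path_upd: "x \<in> paths t \<Longrightarrow> y \<in> X \<Longrightarrow> x(t := y) \<in> paths (Suc t)"
  by (auto simp: paths_eq PiE_iff extensional_def less_Suc_eq)

lemma path_restrict: "x \<in> paths T \<Longrightarrow> t \<le> T \<Longrightarrow> restrict x {..<t} \<in> paths t"
  by (auto simp: paths_eq PiE_iff)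

lemma restrict_path: "x \<in> paths t \<Longrightarrow> restrict x {..<t} = x"
  by (simp add: paths_eq PiE_restrict)

lemma restrict_path_upd: "x \<in> paths t \<Longrightarrow> restrict (x(t := y)) {..<t} = x"
  using restrict_path[of x t] by (auto simp: fun_eq_iff restrict_def split: if_splits)

lemma path_coord: "x \<in> paths T \<Longrightarrow> i < T \<Longrightarrow> x i \<in> X"
  by (auto simp: paths_eq)

lemma path_Suc_cases:
  assumes "x \<in> paths (Suc t)"
  obtains x' y where "x' \<in> paths t" "y \<in> X" "x = x'(t := y)"
proof
  show "restrict x {..<t} \<in> paths t" "x t \<in> X" using assms by (auto simp: path_restrict path_coord)
  show "x = (restrict x {..<t})(t := x t)"
    using assms by (auto simp: fun_eq_iff paths_eq PiE_iff extensional_def restrict_def less_Suc_eq)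
qed

text \<open>Analytic sets are taken in the full space \<open>nat \<Rightarrow> real\<close> with the
  product topology. There a path of length \<open>t\<close> is a sequence pinned to
  \<open>undefined\<close> from coordinate \<open>t\<close> on, a countable conjunction of Borel
  conditions.\<close>

lemma paths_borel: "paths t \<in> sets borel"
proof -
  have "paths t = (\<Inter>i. {x. if i < t then x i \<in> X else x i = undefined})"
    by (auto simp: paths_eq PiE_iff extensional_def split: if_splits)
  also have "\<dots> \<in> sets borel"
  proof (rule sets.countable_INT'[of UNIV])
    have coord: "{x. x i \<in> Y} \<in> sets borel" if "Y \<in> sets borel" for i :: nat and Y :: "real set"
      using measurable_sets[OF measurable_product_coordinates that, of i] by (simp add: vimage_def)
    show "range (\<lambda>i. {x. if i < t then x i \<in> X else x i = undefined}) \<subseteq> sets borel"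
    proof (rule image_subsetI)
      fix i
      show "{x. if i < t then x i \<in> X else x i = undefined} \<in> sets borel"
        using coord[OF X_borel, of i] coord[of "{undefined}" i] by (cases "i < t") simp_all
    qed
  qed auto
  finally show ?thesis .
qed

lemma measurable_id_XT: "(\<lambda>x. x) \<in> measurable (restrict_space borel (paths t)) (XT X t)"
  unfolding XT_def[of X t]
proof (rule measurable_PiM_single')
  show "(\<lambda>x. x i) \<in> measurable (restrict_space borel (space (Pi\<^sub>M {..<t} (\<lambda>_. restrict_space borel X)))) (restrict_space borel X)"
    if "i \<in> {..<t}" for i
    using that by (intro measurable_restrict_space3[OF measurable_product_coordinates])
       (simp add: space_PiM space_restrict_space PiE_iff)
qed (auto simp: space_restrict_space space_PiM)

text \<open>Extension by zero moves e-variables and capital processes to the full sequence space,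
  where Borel sets are known to be analytic.\<close>

lemma measurable_XT_extend:
  fixes f :: "(nat \<Rightarrow> real) \<Rightarrow> real"
  assumes "f \<in> borel_measurable (XT X t)"
  shows "(\<lambda>x. if x \<in> paths t then f x else 0) \<in> borel_measurable borel"
  using measurable_compose[OF measurable_id_XT assms] paths_borel
  by (subst measurable_restrict_space_iff[symmetric]) auto

lemma measurable_coord_XT: "i < t \<Longrightarrow> (\<lambda>x. x i) \<in> borel_measurable (XT X t)"
  unfolding XT_def
  using measurable_component_singleton[of i "{..<t}" "\<lambda>_. restrict_space borel X"]
  by (simp add: measurable_restrict_space2_iff)

lemma measurable_borel_XT:
  assumes "f \<in> borel_measurable borel"
  shows "f \<in> borel_measurable (XT X t)"
proof -
  have "(\<lambda>x. x) \<in> borel_measurable (XT X t)"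
  proof (rule measurable_coordinatewise_then_product)
    fix i
    show "(\<lambda>x. x i) \<in> borel_measurable (XT X t)"
    proof (cases "i < t")
      case False
      then have "(\<lambda>x. x i) \<in> borel_measurable (XT X t) \<longleftrightarrow> (\<lambda>x. undefined :: real) \<in> borel_measurable (XT X t)"
        by (intro measurable_cong) (auto simp: paths_eq PiE_iff extensional_def)
      then show ?thesis by simp
    qed (rule measurable_coord_XT)
  qed
  then show ?thesis using assms by (rule measurable_compose)
qed

lemma measurable_restrict_XT: "t \<le> T \<Longrightarrow> (\<lambda>x. restrict x {..<t}) \<in> measurable (XT X T) (XT X t)"
  unfolding XT_def by (intro measurable_restrict_subset) auto

lemma sets_filt:
  "t \<le> T \<Longrightarrow> sets (filt X T t) = {(\<lambda>x. restrict x {..<t}) -` B \<inter> paths T | B. B \<in> sets (XT X t)}"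
  unfolding filt_def by (rule sets_vimage_algebra2) (auto simp: path_restrict)

lemma subalgebra_filt:
  assumes "t \<le> T" "sets P = sets (XT X T)"
  shows "subalgebra P (filt X T t)"
proof -
  have "sets (filt X T t) \<subseteq> sets (XT X T)"
    unfolding filt_def by (intro sets_image_in_sets measurable_restrict_XT assms refl)
  then show ?thesis using assms(2) sets_eq_imp_space_eq[OF assms(2)]
    by (simp add: subalgebra_def filt_def)
qed

lemma measurable_restrict_filt: "t \<le> T \<Longrightarrow> (\<lambda>x. restrict x {..<t}) \<in> measurable (filt X T t) (XT X t)"
  unfolding filt_def by (rule measurable_vimage_algebra1) (auto simp: path_restrict)

section \<open>Capital processes of betting strategies\<close>

lemma bet_factor_nonneg:
  assumes "l \<in> {1 / (\<mu> - 1)..1 / \<mu>}" "y \<in> X"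
  shows "0 \<le> 1 + l * (y - \<mu>)"
proof -
  have y: "0 \<le> y" "y \<le> 1" using assms(2) X_unit by auto
  have "l * \<mu> \<le> 1" "- 1 \<le> l * (1 - \<mu>)"
    using assms(1) mu_pos mu_less by (auto simp: field_simps)
  \<comment> \<open>The factor is affine in \<open>y\<close>, hence the mean of its values at 0 and
    1 with weights \<open>1 - y\<close> and \<open>y\<close>; the endpoints of the betting interval
    are the slopes at which one of these values vanishes.\<close>
  then have "0 \<le> (1 - y) * (1 - l * \<mu>) + y * (1 + l * (1 - \<mu>))"
    using y mult_nonneg_nonneg[of "1 - y" "1 - l * \<mu>"] mult_nonneg_nonneg[of y "1 + l * (1 - \<mu>)"]
    by linarith
  then show ?thesis by (simp add: algebra_simps)
qed

text \<open>A crude uniform bound that makes capital processes integrable: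
  \<open>\<bar>l\<bar>\<close> is at most the sum of the absolute values of the two endpoints of the
  betting interval.\<close>

lemma bet_factor_le:
  assumes "l \<in> {1 / (\<mu> - 1)..1 / \<mu>}" "y \<in> X"
  shows "1 + l * (y - \<mu>) \<le> 1 + (1 / \<mu> + 1 / (1 - \<mu>))"
proof -
  have y: "\<bar>y - \<mu>\<bar> \<le> 1" using assms(2) X_unit mu_pos mu_less by (auto simp: subset_eq abs_le_iff)
  have "1 / (\<mu> - 1) = - (1 / (1 - \<mu>))" by (metis minus_diff_eq minus_divide_right)
  moreover have "0 < 1 / \<mu>" "0 < 1 / (1 - \<mu>)" using mu_pos mu_less by auto
  ultimately have "\<bar>l\<bar> \<le> 1 / \<mu> + 1 / (1 - \<mu>)" using assms(1) unfolding atLeastAtMost_iff abs_le_iff by linarith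
  then have "\<bar>l * (y - \<mu>)\<bar> \<le> 1 / \<mu> + 1 / (1 - \<mu>)"
    using mult_mono[OF _ y, of "\<bar>l\<bar>" "1 / \<mu> + 1 / (1 - \<mu>)"] by (simp add: abs_mult)
  then show ?thesis by linarith
qed

lemma Lambda_muD:
  assumes "lam \<in> Lambda_mu X T \<mu>" "t < T"
  shows "lam t \<in> borel_measurable (XT X t)" "x \<in> paths t \<Longrightarrow> lam t x \<in> {1 / (\<mu> - 1)..1 / \<mu>}"
  using assms unfolding Lambda_mu_def by blast+

lemma Lambda_mu_mono: "lam \<in> Lambda_mu X T \<mu> \<Longrightarrow> t \<le> T \<Longrightarrow> lam \<in> Lambda_mu X t \<mu>"
  by (simp add: Lambda_mu_def)

lemma E_lam_0: "x \<in> paths 0 \<Longrightarrow> E_lam X 0 \<mu> lam x = 1"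
  by (simp add: E_lam_def)

lemma E_lam_cong:
  assumes "\<And>s. s < t \<Longrightarrow> lam s = lam' s"
  shows "E_lam X t \<mu> lam = E_lam X t \<mu> lam'"
  unfolding E_lam_def using assms by (auto intro!: prod.cong)

lemma E_lam_upd:
  assumes "x \<in> paths t" "y \<in> X"
  shows "E_lam X (Suc t) \<mu> lam (x(t := y)) = E_lam X t \<mu> lam x * (1 + lam t x * (y - \<mu>))"
proof -
  have "restrict (x(t := y)) {..<s} = restrict x {..<s}" if "s < t" for s
    using that by (auto simp: restrict_def)
  then have "(\<Prod>s<t. 1 + lam s (restrict (x(t := y)) {..<s}) * ((x(t := y)) s - \<mu>)) =
      (\<Prod>s<t. 1 + lam s (restrict x {..<s}) * (x s - \<mu>))"
    by (intro prod.cong) auto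
  then show ?thesis using assms path_upd[OF assms] restrict_path_upd[OF assms(1)]
    by (simp add: E_lam_def del: fun_upd_apply) simp
qed

lemma E_lam_factor:
  assumes "lam \<in> Lambda_mu X t \<mu>" "x \<in> paths t" "s < t"
  shows "0 \<le> 1 + lam s (restrict x {..<s}) * (x s - \<mu>)"
    "1 + lam s (restrict x {..<s}) * (x s - \<mu>) \<le> 1 + (1 / \<mu> + 1 / (1 - \<mu>))"
proof -
  have "restrict x {..<s} \<in> paths s" using assms by (intro path_restrict) auto
  then have "lam s (restrict x {..<s}) \<in> {1 / (\<mu> - 1)..1 / \<mu>}" by (rule Lambda_muD(2)[OF assms(1,3)])
  then show "0 \<le> 1 + lam s (restrict x {..<s}) * (x s - \<mu>)"
    "1 + lam s (restrict x {..<s}) * (x s - \<mu>) \<le> 1 + (1 / \<mu> + 1 / (1 - \<mu>))"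
    using path_coord[OF assms(2,3)] by (rule bet_factor_nonneg bet_factor_le)+
qed

lemma E_lam_nonneg: "lam \<in> Lambda_mu X t \<mu> \<Longrightarrow> 0 \<le> E_lam X t \<mu> lam x"
  unfolding E_lam_def by (cases "x \<in> paths t") (auto intro!: prod_nonneg dest: E_lam_factor(1))

lemma E_lam_le:
  assumes "lam \<in> Lambda_mu X t \<mu>"
  shows "E_lam X t \<mu> lam x \<le> (1 + (1 / \<mu> + 1 / (1 - \<mu>))) ^ t"
proof (cases "x \<in> paths t")
  case True
  have "(\<Prod>s<t. 1 + lam s (restrict x {..<s}) * (x s - \<mu>)) \<le> (\<Prod>s<t. 1 + (1 / \<mu> + 1 / (1 - \<mu>)))"
    by (intro prod_mono conjI E_lam_factor[OF assms True]) simp_all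
  then show ?thesis using True by (simp add: E_lam_def)
next
  case False
  then show ?thesis using mu_pos mu_less by (simp add: E_lam_def)
qed

lemma E_lam_measurable:
  assumes "lam \<in> Lambda_mu X T \<mu>"
  shows "E_lam X T \<mu> lam \<in> borel_measurable (XT X T)"
proof -
  have "(\<lambda>x. \<Prod>t<T. 1 + lam t (restrict x {..<t}) * (x t - \<mu>)) \<in> borel_measurable (XT X T)"
    by (intro borel_measurable_prod borel_measurable_add borel_measurable_times borel_measurable_diff
        borel_measurable_const measurable_coord_XT
        measurable_compose[OF measurable_restrict_XT Lambda_muD(1)[OF assms]]) simp_all
  then show ?thesis
    by (rule measurable_cong[THEN iffD1, rotated]) (simp add: E_lam_def)
qed

text \<open>Nonnegativity of the difference of the capitals passes backward from time
  \<open>T\<close> to every earlier time. Forward in time the difference starts at 0, and each step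
  keeps it 0 because its slope in the next outcome must vanish.\<close>

lemma E_lam_maximal:
  assumes lam: "lam \<in> Lambda_mu X T \<mu>" and lam': "lam' \<in> Lambda_mu X T \<mu>"
    and le: "\<And>x. x \<in> paths T \<Longrightarrow> E_lam X T \<mu> lam x \<le> E_lam X T \<mu> lam' x"
    and x: "x \<in> paths T"
  shows "E_lam X T \<mu> lam x = E_lam X T \<mu> lam' x"
proof -
  define D where "D t x = E_lam X t \<mu> lam' x - E_lam X t \<mu> lam x" for t x
  \<comment> \<open>One step ahead, the difference of the two capital processes is an affine function of the
    next outcome whose value at the mean is the current difference.\<close>
  have aff: "\<exists>a. \<forall>y\<in>X. D (Suc t) (x(t := y)) = D t x + a * (y - \<mu>)" if "x \<in> paths t" for t x
    by (rule exI[of _ "E_lam X t \<mu> lam' x * lam' t x - E_lam X t \<mu> lam x * lam t x"])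
       (use that in \<open>auto simp: D_def E_lam_upd algebra_simps\<close>)
  have nonneg: "0 \<le> D t x" if "t \<le> T" "x \<in> paths t" for t x
    using that
  proof (induction t arbitrary: x rule: inc_induct)
    case base
    then show ?case using le by (simp add: D_def)
  next
    case (step t)
    obtain a where a: "\<forall>y\<in>X. D (Suc t) (x(t := y)) = D t x + a * (y - \<mu>)"
      using aff step.prems by blast
    have "0 \<le> D t x - a * \<mu>" "0 \<le> D t x + a * (1 - \<mu>)"
      using step.IH[OF path_upd[OF step.prems zero_X]] step.IH[OF path_upd[OF step.prems one_X]]
        bspec[OF a zero_X] bspec[OF a one_X] by (simp_all del: fun_upd_apply)
    \<comment> \<open>The right-hand side equals \<open>D t x\<close>: the present difference is the
      mean of its successors at outcomes 0 and 1, with weights \<open>1 - \<mu>\<close> and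
      \<open>\<mu>\<close>.\<close>
    then have "0 \<le> (1 - \<mu>) * (D t x - a * \<mu>) + \<mu> * (D t x + a * (1 - \<mu>))"
      using mu_pos mu_less mult_nonneg_nonneg[of "1 - \<mu>" "D t x - a * \<mu>"]
        mult_nonneg_nonneg[of \<mu> "D t x + a * (1 - \<mu>)"] by linarith
    then show ?case by (simp add: algebra_simps)
  qed
  have "D t x = 0" if "t \<le> T" "x \<in> paths t" for t x
    using that
  proof (induction t arbitrary: x)
    case 0
    then show ?case by (simp add: D_def E_lam_0)
  next
    case (Suc t)
    obtain x' y where x': "x' \<in> paths t" "y \<in> X" "x = x'(t := y)" using Suc.prems path_Suc_cases by blast
    obtain a where a: "\<forall>y\<in>X. D (Suc t) (x'(t := y)) = a * (y - \<mu>)"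
      using aff[OF x'(1)] Suc.IH[OF _ x'(1)] Suc.prems by auto
    have "0 \<le> a * (0 - \<mu>)" "0 \<le> a * (1 - \<mu>)"
      using a zero_X one_X nonneg[OF Suc.prems(1) path_upd[OF x'(1)]] by metis+
    then have "a = 0" using mu_pos mu_less by (auto simp: mult_le_0_iff zero_le_mult_iff)
    then show ?case using a x'(2,3) by (simp del: fun_upd_apply)
  qed
  then show ?thesis using x by (simp add: D_def)
qed

text \<open>Capital grows by \<open>M * l * (x t - \<mu>)\<close> in a step. The factor
  \<open>M * l\<close> is bounded and depends only on the first \<open>t\<close> outcomes, so the
  conditional mean condition makes the expected growth 0.\<close>

lemma integral_E_lam:
  assumes P: "P \<in> H_mu X T \<mu>" and lam: "lam \<in> Lambda_mu X T \<mu>"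
  shows "t \<le> T \<Longrightarrow> (\<integral>x. E_lam X t \<mu> lam (restrict x {..<t}) \<partial>P) = 1"
proof (induction t)
  case 0
  interpret prob_space P using P by (simp add: H_mu_def)
  show ?case by (simp add: E_lam_def paths_eq restrict_def prob_space)
next
  case (Suc t)
  interpret prob_space P using P by (simp add: H_mu_def)
  have sets_P: "sets P = sets (XT X T)" using P by (simp add: H_mu_def)
  have space_P: "space P = paths T" by (rule sets_eq_imp_space_eq[OF sets_P])
  interpret finite_measure_subalgebra P "filt X T t"
    by unfold_locales (rule subalgebra_filt[OF _ sets_P], use Suc.prems in simp)
  define M where "M x = E_lam X t \<mu> lam (restrict x {..<t})" for x
  define l where "l x = lam t (restrict x {..<t})" for x
  have lam_t: "lam \<in> Lambda_mu X t \<mu>" using Lambda_mu_mono[OF lam] Suc.prems by simp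
  have M_meas: "M \<in> borel_measurable (filt X T t)" and l_meas: "l \<in> borel_measurable (filt X T t)"
    unfolding M_def l_def
    using Suc.prems measurable_compose[OF measurable_restrict_filt E_lam_measurable[OF lam_t]]
      measurable_compose[OF measurable_restrict_filt Lambda_muD(1)[OF lam]] by auto
  have coord_meas: "(\<lambda>x. x t) \<in> borel_measurable P"
    using measurable_coord_XT[of t T] Suc.prems measurable_cong_sets[OF sets_P refl] by auto
  define K where "K = 1 / \<mu> + 1 / (1 - \<mu>)"
  have K: "0 \<le> K" using mu_pos mu_less by (simp add: K_def)
  have M_bd: "\<bar>M x\<bar> \<le> (1 + K) ^ t" for x
    using E_lam_nonneg[OF lam_t] E_lam_le[OF lam_t] by (simp add: M_def K_def)
  have l_bd: "\<bar>l x\<bar> \<le> K" if "x \<in> space P" for x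
  proof -
    have "l x \<in> {1 / (\<mu> - 1)..1 / \<mu>}" unfolding l_def
      using that Suc.prems by (intro Lambda_muD(2)[OF lam] path_restrict) (auto simp: space_P)
    moreover have "1 / (\<mu> - 1) = - (1 / (1 - \<mu>))" by (metis minus_diff_eq minus_divide_right)
    moreover have "0 < 1 / \<mu>" "0 < 1 / (1 - \<mu>)" using mu_pos mu_less by auto
    ultimately show ?thesis unfolding K_def atLeastAtMost_iff abs_le_iff by linarith
  qed
  have coord_bd: "\<bar>x t\<bar> \<le> 1" if "x \<in> space P" for x
    using that path_coord[of x T t] X_unit Suc.prems by (auto simp: space_P)
  have Ml_meas: "(\<lambda>x. M x * l x) \<in> borel_measurable (filt X T t)"
    by (intro borel_measurable_times M_meas l_meas)
  note meas_P = measurable_from_subalg[OF subalg]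
  have Ml_bd: "\<bar>M x * l x\<bar> \<le> (1 + K) ^ t * K" if "x \<in> space P" for x
    using M_bd[of x] l_bd[OF that] K unfolding abs_mult by (intro mult_mono) auto
  have int_M: "integrable P M"
    by (rule integrable_const_bound[of _ "(1 + K) ^ t"]) (auto simp: M_bd meas_P[OF M_meas])
  have int_Ml: "integrable P (\<lambda>x. M x * l x)"
    by (rule integrable_const_bound[of _ "(1 + K) ^ t * K"]) (auto simp: Ml_bd meas_P[OF Ml_meas])
  have int_Mlx: "integrable P (\<lambda>x. M x * l x * x t)"
  proof (rule integrable_const_bound[of _ "(1 + K) ^ t * K * 1"])
    show "AE x in P. norm (M x * l x * x t) \<le> (1 + K) ^ t * K * 1"
    proof (rule AE_I2)
      fix x assume "x \<in> space P"
      then show "norm (M x * l x * x t) \<le> (1 + K) ^ t * K * 1"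
        using Ml_bd[of x] coord_bd[of x] K unfolding real_norm_def abs_mult[of "M x * l x"]
        by (intro mult_mono) auto
    qed
  qed (intro borel_measurable_times coord_meas meas_P[OF M_meas] meas_P[OF l_meas])
  have "AE x in P. real_cond_exp P (filt X T t) (\<lambda>x. x t) x = \<mu>"
    using P Suc.prems by (auto simp: H_mu_def)
  then have "(\<integral>x. M x * l x * real_cond_exp P (filt X T t) (\<lambda>x. x t) x \<partial>P) = (\<integral>x. M x * l x * \<mu> \<partial>P)"
    by (intro integral_cong_AE borel_measurable_times borel_measurable_const meas_P[OF M_meas] meas_P[OF l_meas])
       auto
  \<comment> \<open>Since \<open>M x * l x\<close> is measurable for the past, the next outcome may
    be exchanged under the integral for its conditional expectation.\<close>
  then have eq: "(\<integral>x. M x * l x * x t \<partial>P) = (\<integral>x. M x * l x * \<mu> \<partial>P)"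
    using real_cond_exp_intg(2)[OF int_Mlx Ml_meas coord_meas] by simp
  have M_1: "(\<integral>x. M x \<partial>P) = 1"
    unfolding M_def by (rule Suc.IH) (use Suc.prems in simp)
  have "(\<integral>x. E_lam X (Suc t) \<mu> lam (restrict x {..<Suc t}) \<partial>P) = (\<integral>x. M x + (M x * l x * x t - M x * l x * \<mu>) \<partial>P)"
  proof (rule Bochner_Integration.integral_cong[OF refl])
    fix x assume "x \<in> space P"
    then have x: "x \<in> paths T" by (simp add: space_P)
    have "restrict x {..<Suc t} = (restrict x {..<t})(t := x t)"
      by (auto simp: restrict_def fun_eq_iff less_Suc_eq)
    then show "E_lam X (Suc t) \<mu> lam (restrict x {..<Suc t}) = M x + (M x * l x * x t - M x * l x * \<mu>)"
      using E_lam_upd[OF path_restrict[OF x] path_coord[OF x], of t t lam] Suc.prems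
      by (simp add: M_def l_def algebra_simps)
  qed
  also have "\<dots> = (\<integral>x. M x \<partial>P) + ((\<integral>x. M x * l x * x t \<partial>P) - (\<integral>x. M x * l x * \<mu> \<partial>P))"
    using int_M int_Ml int_Mlx by simp
  also have "\<dots> = 1" using eq M_1 by simp
  finally show ?case .
qed

lemma E_lam_evar:
  assumes lam: "lam \<in> Lambda_mu X T \<mu>"
  shows "E_lam X T \<mu> lam \<in> evars (XT X T) (H_mu X T \<mu>)"
proof -
  have "(\<integral>\<^sup>+x. ennreal (E_lam X T \<mu> lam x) \<partial>P) \<le> 1" if P: "P \<in> H_mu X T \<mu>" for P
  proof -
    interpret prob_space P using P by (simp add: H_mu_def)
    have sets_P: "sets P = sets (XT X T)" using P by (simp add: H_mu_def)
    have space_P: "space P = paths T" by (rule sets_eq_imp_space_eq[OF sets_P])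
    have "E_lam X T \<mu> lam \<in> borel_measurable P"
      using E_lam_measurable[OF lam] measurable_cong_sets[OF sets_P refl] by auto
    then have "integrable P (E_lam X T \<mu> lam)"
      by (rule integrable_const_bound[of _ "(1 + (1 / \<mu> + 1 / (1 - \<mu>))) ^ T", rotated])
         (simp add: E_lam_nonneg[OF lam] E_lam_le[OF lam])
    then have "(\<integral>\<^sup>+x. ennreal (E_lam X T \<mu> lam x) \<partial>P) = ennreal (\<integral>x. E_lam X T \<mu> lam x \<partial>P)"
      by (rule nn_integral_eq_integral) (simp add: E_lam_nonneg[OF lam])
    also have "(\<integral>x. E_lam X T \<mu> lam x \<partial>P) = (\<integral>x. E_lam X T \<mu> lam (restrict x {..<T}) \<partial>P)"
      by (rule Bochner_Integration.integral_cong) (simp_all add: space_P restrict_path)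
    also have "\<dots> = 1" by (rule integral_E_lam[OF P lam order_refl])
    finally show ?thesis by simp
  qed
  then show ?thesis
    using E_lam_measurable[OF lam] E_lam_nonneg[OF lam] by (auto simp: evars_def) (simp add: E_lam_def)
qed

subsection \<open>Attainable expectations\<close>

text \<open>Expectations of at least \<open>c\<close> that the continuation of a path by a finitely branching martingale
  can achieve; each step moves to two outcomes with the barycentric weights of the mean.\<close>
primrec attainable :: "nat \<Rightarrow> ((nat \<Rightarrow> real) \<Rightarrow> real) \<Rightarrow> nat \<Rightarrow> ((nat \<Rightarrow> real) \<times> real) set" where
  "attainable T E 0 = {(x, c). x \<in> paths T \<and> 0 \<le> c \<and> c \<le> E x}"
| "attainable T E (Suc k) = {(x, c). \<exists>y z a b. y \<in> X \<and> z \<in> X \<and> y \<le> \<mu> \<and> \<mu> < z \<and>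
     (x(T - Suc k := y), a) \<in> attainable T E k \<and> (x(T - Suc k := z), b) \<in> attainable T E k \<and>
     c * (z - y) = (z - \<mu>) * a + (\<mu> - y) * b}"

lemma analytic_Collect_mem_X: "continuous_on UNIV f \<Longrightarrow> analytic {p. f p \<in> X}"
  by (intro analytic_vimage analytic_borel X_borel)

text \<open>The recursion uses only Borel and closed conditions, conjunctions, pullbacks along path
  updates and quantifiers over reals. The barycentric identity is multiplied out by
  \<open>z - y\<close>, which makes it an equation between continuous functions and so a closed
  condition.\<close>

lemma analytic_attainable:
  assumes E: "E \<in> borel_measurable (XT X T)"
  shows "analytic (attainable T E k)"
proof (induction k)
  case 0
  let ?E = "\<lambda>x. if x \<in> paths T then E x else 0"
  have [measurable]: "fst \<in> borel_measurable (borel :: ((nat \<Rightarrow> real) \<times> real) measure)"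
    "snd \<in> borel_measurable (borel :: ((nat \<Rightarrow> real) \<times> real) measure)"
    by (auto intro!: borel_measurable_continuous_onI continuous_on_fst continuous_on_snd continuous_on_id)
  have [measurable]: "?E \<in> borel_measurable borel" by (rule measurable_XT_extend[OF E])
  have [measurable]: "paths T \<in> sets borel" by (rule paths_borel)
  have "{p \<in> space (borel :: ((nat \<Rightarrow> real) \<times> real) measure). fst p \<in> paths T \<and> 0 \<le> snd p \<and> snd p \<le> ?E (fst p)} \<in> sets borel"
    by measurable
  also have "{p \<in> space (borel :: ((nat \<Rightarrow> real) \<times> real) measure). fst p \<in> paths T \<and> 0 \<le> snd p \<and> snd p \<le> ?E (fst p)} = attainable T E 0"
    by auto
  finally show ?case by (rule analytic_borel)
next
  case (Suc k)
  have "analytic {p. \<exists>y z a b. y \<in> X \<and> z \<in> X \<and> y \<le> \<mu> \<and> \<mu> < z \<and>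
     ((fst p)(T - Suc k := y), a) \<in> attainable T E k \<and> ((fst p)(T - Suc k := z), b) \<in> attainable T E k \<and>
     snd p * (z - y) = (z - \<mu>) * a + (\<mu> - y) * b}"
    by (intro analytic_ex analytic_conj analytic_Collect_mem_X analytic_vimage[OF Suc.IH]
        analytic_closed[OF closed_Collect_le] analytic_open[OF open_Collect_less]
        analytic_closed[OF closed_Collect_eq] continuous_on_fun_upd continuous_on_Pair continuous_on_fst
        continuous_on_snd continuous_on_id continuous_on_const continuous_on_add continuous_on_diff
        continuous_on_mult)
  then show ?case by (simp add: case_prod_unfold)
qed

text \<open>Attainability of 0 at every path is what later confines the next bet to the betting
  interval, through the outcomes 0 and 1.\<close>

lemma attainable_0:
  assumes "\<And>x. x \<in> paths T \<Longrightarrow> 0 \<le> E x"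
  shows "k \<le> T \<Longrightarrow> x \<in> paths (T - k) \<Longrightarrow> (x, 0) \<in> attainable T E k"
proof (induction k arbitrary: x)
  case (Suc k)
  have "T - k = Suc (T - Suc k)" using Suc.prems by simp
  then have zero: "(x(T - Suc k := y), 0) \<in> attainable T E k" if "y \<in> X" for y
    using Suc that path_upd by (metis Suc_leD)
  show ?case
    unfolding attainable.simps mem_Collect_eq case_prod_conv
    by (rule exI[of _ 0], rule exI[of _ 1], rule exI[of _ 0], rule exI[of _ 0])
       (use zero[OF zero_X] zero[OF one_X] zero_X one_X mu_pos mu_less in simp)
qed (use assms in auto)

text \<open>\<open>k\<close> counts the remaining steps. The law \<open>Q\<close> first tosses a
  coin between the outcomes \<open>y\<close> and \<open>z\<close> and then follows the law given by
  induction for that branch. Its support is finite, so the martingale condition can be tested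
  against arbitrary functions \<open>h\<close> of the past.\<close>

lemma attainable_expectation:
  assumes "(x, c) \<in> attainable T E k" "k \<le> T" "x \<in> paths (T - k)"
  shows "\<exists>Q. finite (set_pmf Q) \<and> set_pmf Q \<subseteq> paths T \<and> (\<forall>w\<in>set_pmf Q. restrict w {..<T - k} = x) \<and>
    c \<le> measure_pmf.expectation Q E \<and>
    (\<forall>s h. T - k \<le> s \<longrightarrow> s < T \<longrightarrow> measure_pmf.expectation Q (\<lambda>w. (w s - \<mu>) * h (restrict w {..<s})) = 0)"
  using assms
proof (induction k arbitrary: x c)
  case 0
  then show ?case by (intro exI[of _ "return_pmf x"]) (auto simp: restrict_path)
next
  case (Suc k)
  define t where "t = T - Suc k"
  have t: "T - k = Suc t" "t < T" using Suc.prems by (auto simp: t_def)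
  have x: "x \<in> paths t" using Suc.prems by (simp add: t_def)
  obtain y z a b where yz: "y \<in> X" "z \<in> X" "y \<le> \<mu>" "\<mu> < z"
    and a: "(x(t := y), a) \<in> attainable T E k" and b: "(x(t := z), b) \<in> attainable T E k"
    and c: "c * (z - y) = (z - \<mu>) * a + (\<mu> - y) * b"
    using Suc.prems(1) by (auto simp: t_def simp del: fun_upd_apply)
  have k: "k \<le> T" using Suc.prems(2) by simp
  have "x(t := y) \<in> paths (T - k)" using path_upd[OF x] yz t by simp
  from Suc.IH[OF a k this, unfolded t(1)] obtain Qy where Qy:
    "finite (set_pmf Qy)" "set_pmf Qy \<subseteq> paths T" "\<forall>w\<in>set_pmf Qy. restrict w {..<Suc t} = x(t := y)"
    "a \<le> measure_pmf.expectation Qy E"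
    "\<forall>s h. Suc t \<le> s \<longrightarrow> s < T \<longrightarrow> measure_pmf.expectation Qy (\<lambda>w. (w s - \<mu>) * h (restrict w {..<s})) = 0"
    by blast
  have "x(t := z) \<in> paths (T - k)" using path_upd[OF x] yz t by simp
  from Suc.IH[OF b k this, unfolded t(1)] obtain Qz where Qz:
    "finite (set_pmf Qz)" "set_pmf Qz \<subseteq> paths T" "\<forall>w\<in>set_pmf Qz. restrict w {..<Suc t} = x(t := z)"
    "b \<le> measure_pmf.expectation Qz E"
    "\<forall>s h. Suc t \<le> s \<longrightarrow> s < T \<longrightarrow> measure_pmf.expectation Qz (\<lambda>w. (w s - \<mu>) * h (restrict w {..<s})) = 0"
    by blast
  \<comment> \<open>\<open>q\<close> is the weight of \<open>z\<close> for which the next outcome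
    has mean \<open>\<mu>\<close>; the identity for \<open>c\<close> then reads
    \<open>c = q * b + (1 - q) * a\<close>.\<close>
  define q where "q = (\<mu> - y) / (z - y)"
  have q: "0 \<le> q" "q \<le> 1" and q': "1 - q = (z - \<mu>) / (z - y)"
    using yz by (auto simp: q_def field_simps)
  define Q where "Q = bernoulli_pmf q \<bind> (\<lambda>i. if i then Qz else Qy)"
  have exp_Q: "measure_pmf.expectation Q f = q * measure_pmf.expectation Qz f + (1 - q) * measure_pmf.expectation Qy f"
    for f :: "(nat \<Rightarrow> real) \<Rightarrow> real"
    unfolding Q_def using q Qy(1) Qz(1)
    by (subst pmf_expectation_bind[of UNIV]) (auto simp: UNIV_bool)
  have set_Q: "set_pmf Q \<subseteq> set_pmf Qy \<union> set_pmf Qz" by (auto simp: Q_def split: if_splits)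
  have branch: "restrict w {..<t} = x \<and> w t = v" if "restrict w {..<Suc t} = x(t := v)" for w v
  proof
    have "restrict w {..<t} = restrict (restrict w {..<Suc t}) {..<t}" by (auto simp: restrict_def)
    then show "restrict w {..<t} = x" using restrict_path_upd[OF x] that by simp
    show "w t = v" using fun_cong[OF that, of t] by simp
  qed
  \<comment> \<open>At time \<open>t\<close> the past is the fixed path \<open>x\<close>, and the
    deviations of \<open>y\<close> and \<open>z\<close> from \<open>\<mu>\<close> cancel by the
    choice of \<open>q\<close>. Later times are inherited from the branches.\<close>
  have "measure_pmf.expectation Q (\<lambda>w. (w s - \<mu>) * h (restrict w {..<s})) = 0" if s: "t \<le> s" "s < T" for s h
  proof (cases "s = t")
    case True
    have const: "measure_pmf.expectation R (\<lambda>w. (w t - \<mu>) * h (restrict w {..<t})) = (v - \<mu>) * h x"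
      if "\<forall>w\<in>set_pmf R. restrict w {..<Suc t} = x(t := v)" for R v
    proof -
      have "measure_pmf.expectation R (\<lambda>w. (w t - \<mu>) * h (restrict w {..<t})) = measure_pmf.expectation R (\<lambda>w. (v - \<mu>) * h x)"
        by (rule integral_cong_AE) (use branch that in \<open>auto simp: AE_measure_pmf_iff\<close>)
      then show ?thesis by simp
    qed
    have "q * (z - \<mu>) + (1 - q) * (y - \<mu>) = 0"
      unfolding q' unfolding q_def using yz by (simp add: field_simps)
    then have "q * ((z - \<mu>) * h x) + (1 - q) * ((y - \<mu>) * h x) = 0"
      by (metis distrib_right mult.assoc mult_zero_left)
    then show ?thesis unfolding True exp_Q const[OF Qy(3)] const[OF Qz(3)] .
  next
    case False
    then show ?thesis using s Qy(5) Qz(5) by (simp add: exp_Q)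
  qed
  moreover have "c \<le> measure_pmf.expectation Q E"
  proof -
    have "c = ((z - \<mu>) * a + (\<mu> - y) * b) / (z - y)" using c yz by (simp add: eq_divide_eq)
    then have "c = q * b + (1 - q) * a" unfolding q' unfolding q_def by (simp add: add_divide_distrib)
    also have "\<dots> \<le> measure_pmf.expectation Q E"
      unfolding exp_Q using q Qy(4) Qz(4) by (intro add_mono mult_left_mono) auto
    finally show ?thesis .
  qed
  moreover have "finite (set_pmf Q)" "set_pmf Q \<subseteq> paths T"
    using set_Q Qy(1,2) Qz(1,2) finite_subset by blast+
  moreover have "restrict w {..<t} = x" if "w \<in> set_pmf Q" for w
    using that set_Q branch Qy(3) Qz(3) by blast
  ultimately show ?case unfolding t_def[symmetric] by blast
qed

text \<open>A pmf is a measure on all subsets of the sequence space, whereas the hypothesis concerns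
  measures on \<open>XT X T\<close>. The map \<open>g\<close> pushes \<open>Q\<close> into path
  space and fixes its support.\<close>

lemma martingale_pmf_in_H_mu:
  assumes fin: "finite (set_pmf Q)" and supp: "set_pmf Q \<subseteq> paths T"
    and mart: "\<And>s h. s < T \<Longrightarrow> measure_pmf.expectation Q (\<lambda>w. (w s - \<mu>) * h (restrict w {..<s})) = 0"
    and g: "g \<in> measurable (measure_pmf Q) (XT X T)" "\<And>w. w \<in> set_pmf Q \<Longrightarrow> g w = w"
  shows "distr (measure_pmf Q) (XT X T) g \<in> H_mu X T \<mu>"
proof -
  define P where "P = distr (measure_pmf Q) (XT X T) g"
  have sets_P: "sets P = sets (XT X T)" by (simp add: P_def)
  have "prob_space P" unfolding P_def by (rule measure_pmf.prob_space_distr[OF g(1)])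
  then interpret prob_space P .
  have "AE x in P. real_cond_exp P (filt X T t) (\<lambda>x. x t) x = \<mu>" if "t < T" for t
  proof -
    interpret finite_measure_subalgebra P "filt X T t"
      by unfold_locales (rule subalgebra_filt[OF _ sets_P], use that in simp)
    have coord: "(\<lambda>x. x t) \<in> borel_measurable (XT X T)" by (rule measurable_coord_XT[OF that])
    have int_P: "integrable P (\<lambda>x. x t)"
      unfolding P_def integrable_distr_eq[OF g(1) coord] by (rule integrable_measure_pmf_finite[OF fin])
    show ?thesis
    proof (rule real_cond_exp_charact)
      fix A assume "A \<in> sets (filt X T t)"
      then have A: "A \<in> sets (XT X T)"
        using subalgebra_filt[OF less_imp_le[OF \<open>t < T\<close>] sets_P] sets_P unfolding subalgebra_def by blast
      \<comment> \<open>An event of the past is a condition \<open>B\<close> on the restricted path,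
        so the martingale condition with \<open>h\<close> the indicator of \<open>B\<close> gives
        the required equality of integrals.\<close>
      obtain B where B: "A = (\<lambda>x. restrict x {..<t}) -` B \<inter> paths T"
        using \<open>A \<in> sets (filt X T t)\<close> unfolding sets_filt[OF less_imp_le[OF \<open>t < T\<close>]] by blast
      have eq: "(\<integral>x. indicator A x * f x \<partial>P) = measure_pmf.expectation Q (\<lambda>w. indicator B (restrict w {..<t}) * f w)"
        if f: "f \<in> borel_measurable (XT X T)" for f :: "(nat \<Rightarrow> real) \<Rightarrow> real"
      proof -
        have "(\<integral>x. indicator A x * f x \<partial>P) = measure_pmf.expectation Q (\<lambda>w. indicator A (g w) * f (g w))"
          unfolding P_def by (intro integral_distr g borel_measurable_times borel_measurable_indicator A f)
        also have "\<dots> = measure_pmf.expectation Q (\<lambda>w. indicator B (restrict w {..<t}) * f w)"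
          by (rule integral_cong_AE)
             (use supp g(2) in \<open>auto simp: AE_measure_pmf_iff B indicator_def\<close>)
        finally show ?thesis .
      qed
      have "measure_pmf.expectation Q (\<lambda>w. indicator B (restrict w {..<t}) * w t - indicator B (restrict w {..<t}) * \<mu>) = 0"
        using mart[OF that, of "indicator B"] by (simp add: algebra_simps)
      then have "measure_pmf.expectation Q (\<lambda>w. indicator B (restrict w {..<t}) * w t) =
          measure_pmf.expectation Q (\<lambda>w. indicator B (restrict w {..<t}) * \<mu>)"
        by (subst (asm) Bochner_Integration.integral_diff) (auto intro: integrable_measure_pmf_finite[OF fin])
      then show "(\<integral>x\<in>A. x t \<partial>P) = (\<integral>x\<in>A. \<mu> \<partial>P)"
        unfolding set_lebesgue_integral_def real_scaleR_def eq[OF coord] eq[OF borel_measurable_const] .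
    qed (use int_P in auto)
  qed
  then show ?thesis using sets_P prob_space_axioms unfolding P_def[symmetric] by (simp add: H_mu_def)
qed

lemma attainable_le_1:
  assumes E: "E \<in> evars (XT X T) (H_mu X T \<mu>)" and x: "x \<in> paths 0" and c: "(x, c) \<in> attainable T E T"
  shows "c \<le> 1"
proof -
  obtain Q where Q: "finite (set_pmf Q)" "set_pmf Q \<subseteq> paths T" "c \<le> measure_pmf.expectation Q E"
    "\<And>s h. s < T \<Longrightarrow> measure_pmf.expectation Q (\<lambda>w. (w s - \<mu>) * h (restrict w {..<s})) = 0"
    using attainable_expectation[OF c order_refl] x by auto
  \<comment> \<open>\<open>w0\<close> is a default path for points outside path space, which carry
    no mass under \<open>Q\<close>.\<close>
  obtain w0 where w0: "w0 \<in> paths T" using Q(2) set_pmf_not_empty[of Q] by blast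
  define g where "g w = (if w \<in> paths T then w else w0)" for w
  have g: "g \<in> measurable (measure_pmf Q) (XT X T)" "\<And>w. w \<in> set_pmf Q \<Longrightarrow> g w = w"
    using w0 Q(2) by (auto simp: g_def measurable_def)
  have E_meas: "E \<in> borel_measurable (XT X T)" and E_nonneg: "\<And>x. 0 \<le> E x"
    using E by (auto simp: evars_def)
  have "ennreal (measure_pmf.expectation Q E) = (\<integral>\<^sup>+w. ennreal (E w) \<partial>measure_pmf Q)"
    by (rule nn_integral_eq_integral[symmetric]) (auto simp: E_nonneg integrable_measure_pmf_finite[OF Q(1)])
  also have "\<dots> = (\<integral>\<^sup>+w. ennreal (E (g w)) \<partial>measure_pmf Q)"
    by (rule nn_integral_cong_AE) (auto simp: AE_measure_pmf_iff g(2))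
  also have "\<dots> = (\<integral>\<^sup>+x. ennreal (E x) \<partial>distr (measure_pmf Q) (XT X T) g)"
    using E_meas by (subst nn_integral_distr[OF g(1)]) auto
  also have "\<dots> \<le> 1"
    using E martingale_pmf_in_H_mu[OF Q(1,2,4) g] by (auto simp: evars_def)
  finally show ?thesis using Q(3) by simp
qed

subsection \<open>Borel bets\<close>

text \<open>For \<open>S\<close> above the mean these are the points where slope \<open>r\<close> is
  too small for some attainable value, for \<open>S\<close> below the mean those where it is too
  large. The capital \<open>G\<close> is Borel, so the final inequality is a Borel
  condition.\<close>

lemma analytic_bet_bound:
  assumes E: "E \<in> borel_measurable (XT X T)"
    and G: "G \<in> borel_measurable borel" and S: "S \<in> sets borel"
  shows "analytic {x. 0 < G x \<and> (\<exists>y c. y \<in> X \<and> y \<in> S \<and> (x(t := y), c) \<in> attainable T E k \<and>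
    G x * (1 + r * (y - \<mu>)) < c)}"
proof -
  have [measurable]: "fst \<in> borel_measurable (borel :: (((nat \<Rightarrow> real) \<times> real) \<times> real) measure)"
    "fst \<in> borel_measurable (borel :: ((nat \<Rightarrow> real) \<times> real) measure)"
    "snd \<in> borel_measurable (borel :: ((nat \<Rightarrow> real) \<times> real) measure)"
    "snd \<in> borel_measurable (borel :: (((nat \<Rightarrow> real) \<times> real) \<times> real) measure)"
    by (auto intro!: borel_measurable_continuous_onI continuous_on_fst continuous_on_snd continuous_on_id)
  note G[measurable]
  have "(\<lambda>p :: ((nat \<Rightarrow> real) \<times> real) \<times> real. G (fst (fst p)) * (1 + r * (snd (fst p) - \<mu>))) \<in> borel_measurable borel"
    "(snd :: ((nat \<Rightarrow> real) \<times> real) \<times> real \<Rightarrow> real) \<in> borel_measurable borel"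
    by measurable
  then have "analytic {p :: ((nat \<Rightarrow> real) \<times> real) \<times> real. G (fst (fst p)) * (1 + r * (snd (fst p) - \<mu>)) < snd p}"
    by (rule analytic_less)
  then show ?thesis
    by (intro analytic_conj analytic_less[OF borel_measurable_const G] analytic_ex analytic_Collect_mem_X
        analytic_vimage[OF analytic_attainable[OF E]] analytic_vimage[OF analytic_borel[OF S]]
        continuous_on_fun_upd continuous_on_Pair continuous_on_fst continuous_on_snd continuous_on_id)
qed

text \<open>Outcomes above the mean bound the slope from below, outcomes below it bound the slope
  from above. \<open>G_bound\<close> makes the bounds compatible, and \<open>borel_insertion\<close>
  selects a Borel slope between them.\<close>

lemma exists_bet:
  assumes E: "E \<in> borel_measurable (XT X T)" and E_nonneg: "\<And>x. x \<in> paths T \<Longrightarrow> 0 \<le> E x"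
    and k: "k < T" and t: "t = T - Suc k"
    and G: "G \<in> borel_measurable (XT X t)" "\<And>x. x \<in> paths t \<Longrightarrow> 0 \<le> G x"
    and G_bound: "\<And>x c. x \<in> paths t \<Longrightarrow> (x, c) \<in> attainable T E (Suc k) \<Longrightarrow> c \<le> G x"
  obtains l where "l \<in> borel_measurable (XT X t)" "\<And>x. l x \<in> {1 / (\<mu> - 1)..1 / \<mu>}"
    "\<And>x y c. x \<in> paths t \<Longrightarrow> y \<in> X \<Longrightarrow> (x(t := y), c) \<in> attainable T E k \<Longrightarrow> c \<le> G x * (1 + l x * (y - \<mu>))"
proof -
  let ?L = "attainable T E k"
  have t_Suc: "T - k = Suc t" using k t by simp
  have mix: "(z - \<mu>) * a + (\<mu> - y) * b \<le> G x * (z - y)"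
    if "x \<in> paths t" "y \<in> X" "z \<in> X" "y \<le> \<mu>" "\<mu> < z" "(x(t := y), a) \<in> ?L" "(x(t := z), b) \<in> ?L" for x y z a b
  proof -
    have "(x, ((z - \<mu>) * a + (\<mu> - y) * b) / (z - y)) \<in> attainable T E (Suc k)"
      unfolding attainable.simps mem_Collect_eq case_prod_conv t[symmetric]
      by (rule exI[of _ y], rule exI[of _ z], rule exI[of _ a], rule exI[of _ b]) (use that in simp)
    from G_bound[OF that(1) this] show ?thesis using that by (simp add: divide_le_eq)
  qed
  have L_0: "(x(t := y), 0) \<in> ?L" if "x \<in> paths t" "y \<in> X" for x y
    using attainable_0[OF E_nonneg, where k = k] path_upd[OF that] k t_Suc by auto
  define H where "H x = (if x \<in> paths t then G x else 0)" for x
  have H: "H \<in> borel_measurable borel" unfolding H_def by (rule measurable_XT_extend[OF G(1)])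
  \<comment> \<open>Where the capital is 0, all attainable values after the next outcome are at most
    0 and any slope serves; slopes are selected on \<open>W\<close> only.\<close>
  define W where "W = {x. 0 < H x}"
  have W: "W \<in> sets borel" using borel_measurable_less[OF borel_measurable_const H] by (simp add: W_def)
  have W_D: "x \<in> paths t" "H x = G x" "0 < G x" if "x \<in> W" for x
    using that by (auto simp: W_def H_def split: if_splits)
  define A where "A S r = {x. 0 < H x \<and> (\<exists>y c. y \<in> X \<and> y \<in> S \<and> (x(t := y), c) \<in> ?L \<and>
    H x * (1 + of_rat r * (y - \<mu>)) < c)}" for S :: "real set" and r :: rat
  have A_I: "x \<in> A S r" if "x \<in> W" "y \<in> X" "y \<in> S" "(x(t := y), c) \<in> ?L" "G x * (1 + of_rat r * (y - \<mu>)) < c"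
    for x S r y c
    using that W_D(2)[OF that(1)] unfolding A_def W_def mem_Collect_eq by metis
  have disj: "A {\<mu><..} r \<inter> A {..<\<mu>} r = {}" for r
  proof (rule ccontr)
    assume "A {\<mu><..} r \<inter> A {..<\<mu>} r \<noteq> {}"
    then obtain x y z a b where x: "x \<in> W" and yz: "y \<in> X" "z \<in> X" "y < \<mu>" "\<mu> < z"
      and ab: "(x(t := y), a) \<in> ?L" "(x(t := z), b) \<in> ?L"
        "H x * (1 + of_rat r * (y - \<mu>)) < a" "H x * (1 + of_rat r * (z - \<mu>)) < b"
      unfolding A_def W_def by (auto simp del: fun_upd_apply)
    \<comment> \<open>With these weights the terms in the slope \<open>r\<close> cancel and the left
      side is \<open>H x * (z - y)\<close>, contradicting \<open>mix\<close>.\<close>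
    have "(z - \<mu>) * (H x * (1 + of_rat r * (y - \<mu>))) + (\<mu> - y) * (H x * (1 + of_rat r * (z - \<mu>)))
        < (z - \<mu>) * a + (\<mu> - y) * b"
      using ab yz by (intro add_strict_mono mult_strict_left_mono) auto
    also have "\<dots> \<le> G x * (z - y)" using mix[OF W_D(1)[OF x] yz(1,2) _ yz(4) ab(1,2)] yz(3) by simp
    finally show False using W_D(2)[OF x] by (simp add: algebra_simps)
  qed
  have mono: "A {..<\<mu>} r \<subseteq> A {..<\<mu>} s" if rs: "r \<le> s" for r s
  proof
    fix x assume x: "x \<in> A {..<\<mu>} r"
    obtain y c where y: "0 < H x" "y \<in> X" "y < \<mu>" "(x(t := y), c) \<in> ?L" "H x * (1 + of_rat r * (y - \<mu>)) < c"
      using x unfolding A_def by (auto simp del: fun_upd_apply)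
    have "H x * (1 + of_rat s * (y - \<mu>)) \<le> H x * (1 + of_rat r * (y - \<mu>))"
      using y rs by (intro mult_left_mono add_left_mono mult_right_mono_neg) (auto simp: of_rat_less_eq)
    then have "H x * (1 + of_rat s * (y - \<mu>)) < c" using y(5) by (rule le_less_trans)
    then show "x \<in> A {..<\<mu>} s" using y(1-4) unfolding A_def mem_Collect_eq lessThan_iff by blast
  qed
  \<comment> \<open>A slope below the interval makes the factor negative at outcome 1, where the
    value 0 is attainable; \<open>high\<close> argues likewise at outcome 0.\<close>
  have low: "x \<in> A {\<mu><..} r" if "x \<in> W" "of_rat r < 1 / (\<mu> - 1)" for x r
  proof (rule A_I[OF that(1) one_X _ L_0[OF W_D(1)[OF that(1)] one_X]])
    have "1 + of_rat r * (1 - \<mu>) < 0" using that(2) mu_less by (simp add: field_simps)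
    then show "G x * (1 + of_rat r * (1 - \<mu>)) < 0" using W_D(3)[OF that(1)] by (rule mult_pos_neg[rotated])
  qed (use mu_less in simp)
  have high: "x \<in> A {..<\<mu>} r" if "x \<in> W" "1 / \<mu> < of_rat r" for x r
  proof (rule A_I[OF that(1) zero_X _ L_0[OF W_D(1)[OF that(1)] zero_X]])
    have "1 + of_rat r * (0 - \<mu>) < 0" using that(2) mu_pos by (simp add: field_simps)
    then show "G x * (1 + of_rat r * (0 - \<mu>)) < 0" using W_D(3)[OF that(1)] by (rule mult_pos_neg[rotated])
  qed (use mu_pos in simp)
  have "analytic (A {\<mu><..} r)" "analytic (A {..<\<mu>} r)" for r
    unfolding A_def by (rule analytic_bet_bound[OF E H]; simp)+
  from borel_insertion[where A = "A {\<mu><..}" and B = "A {..<\<mu>}" and l = "1 / (\<mu> - 1)" and u = "1 / \<mu>",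
      OF W this disj mono low high]
  obtain l where l: "l \<in> borel_measurable borel"
    "\<forall>x\<in>W. (\<forall>r. x \<in> A {\<mu><..} r \<longrightarrow> of_rat r \<le> l x) \<and> (\<forall>r. x \<in> A {..<\<mu>} r \<longrightarrow> l x \<le> of_rat r) \<and>
      1 / (\<mu> - 1) \<le> l x \<and> l x \<le> 1 / \<mu>"
    "\<forall>x. x \<notin> W \<longrightarrow> l x = 1 / (\<mu> - 1)"
    by auto
  have "c \<le> G x * (1 + l x * (y - \<mu>))" if x: "x \<in> paths t" and y: "y \<in> X" and c: "(x(t := y), c) \<in> ?L" for x y c
  proof -
    \<comment> \<open>The outcome \<open>y\<close> is paired with the opposite extreme outcome, at
      which the value 0 is attained.\<close>
    have at_most: "(1 - \<mu>) * c \<le> G x * (1 - y)" if "y \<le> \<mu>"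
      using mix[OF x y one_X that mu_less c L_0[OF x one_X]] by simp
    have at_least: "\<mu> * c \<le> G x * y" if "\<mu> < y"
      using mix[OF x zero_X y _ that L_0[OF x zero_X] c] mu_pos by simp
    show ?thesis
    proof (cases "x \<in> W")
      case False
      then have "G x = 0" using x G(2)[OF x] by (simp add: W_def H_def)
      then have "c \<le> 0" using at_most at_least mu_pos mu_less by (cases "y \<le> \<mu>") (auto simp: mult_le_0_iff)
      then show ?thesis using \<open>G x = 0\<close> by simp
    next
      case True
      note G_pos = W_D(3)[OF True]
      consider "y = \<mu>" | "\<mu> < y" | "y < \<mu>" by linarith
      then show ?thesis
      proof cases
        \<comment> \<open>At the mean the slope has no effect; here \<open>at_most\<close> gives
          \<open>c \<le> G x\<close> directly.\<close>
        case 1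
        then show ?thesis using at_most mu_less by (simp add: mult.commute)
      next
        case 2
        show ?thesis
        proof (rule ccontr)
          assume "\<not> ?thesis"
          \<comment> \<open>The quotient is the slope needed to reach \<open>c\<close> at
            \<open>y\<close>. A rational strictly between \<open>l x\<close> and it is too small a
            slope, yet exceeds \<open>l x\<close>.\<close>
          then have "l x < (c / G x - 1) / (y - \<mu>)" using 2 G_pos by (simp add: field_simps)
          then obtain r where r: "l x < of_rat r" "of_rat r < (c / G x - 1) / (y - \<mu>)" using of_rat_dense by blast
          have "x \<in> A {\<mu><..} r"
            by (rule A_I[OF True y _ c]) (use r(2) 2 G_pos in \<open>simp_all add: field_simps\<close>)
          then have "of_rat r \<le> l x" using l(2) True by blast
          then show False using r(1) by simp
        qed
      next
        case 3
        show ?thesis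
        proof (rule ccontr)
          assume "\<not> ?thesis"
          then have "(1 - c / G x) / (\<mu> - y) < l x" using 3 G_pos by (simp add: field_simps)
          then obtain r where r: "(1 - c / G x) / (\<mu> - y) < of_rat r" "of_rat r < l x" using of_rat_dense by blast
          have "x \<in> A {..<\<mu>} r"
            by (rule A_I[OF True y _ c]) (use r(1) 3 G_pos in \<open>simp_all add: field_simps\<close>)
          then have "l x \<le> of_rat r" using l(2) True by blast
          then show False using r(2) by simp
        qed
      qed
    qed
  qed
  moreover have "l x \<in> {1 / (\<mu> - 1)..1 / \<mu>}" for x
  proof (cases "x \<in> W")
    case False
    have "1 / (\<mu> - 1) \<le> 0" "0 \<le> 1 / \<mu>" using mu_pos mu_less by (auto simp: divide_le_0_iff)
    then have "1 / (\<mu> - 1) \<le> 1 / \<mu>" by (rule order_trans)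
    then show ?thesis using l(3) False by simp
  qed (use l(2) in simp)
  ultimately show ?thesis using that measurable_borel_XT[OF l(1)] by blast
qed

section \<open>Majorisation and optimality of the betting class\<close>

lemma E_lam_majorises:
  assumes E: "E \<in> evars (XT X T) (H_mu X T \<mu>)"
  shows "\<exists>lam\<in>Lambda_mu X T \<mu>. \<forall>x\<in>paths T. E x \<le> E_lam X T \<mu> lam x"
proof -
  have E_meas: "E \<in> borel_measurable (XT X T)" and E_nonneg: "\<And>x. x \<in> paths T \<Longrightarrow> 0 \<le> E x"
    using E by (auto simp: evars_def)
  \<comment> \<open>The invariant: the capital after \<open>t\<close> steps dominates every value
    attainable in the remaining \<open>T - t\<close>. Initially the capital is 1 and
    \<open>attainable_le_1\<close> applies.\<close>
  have "\<exists>lam\<in>Lambda_mu X t \<mu>. \<forall>x\<in>paths t. \<forall>c. (x, c) \<in> attainable T E (T - t) \<longrightarrow> c \<le> E_lam X t \<mu> lam x"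
    if "t \<le> T" for t
    using that
  proof (induction t)
    case 0
    then show ?case using attainable_le_1[OF E] by (auto simp: E_lam_0 Lambda_mu_def)
  next
    case (Suc t)
    then obtain lam where lam: "lam \<in> Lambda_mu X t \<mu>"
      "\<And>x c. x \<in> paths t \<Longrightarrow> (x, c) \<in> attainable T E (T - t) \<Longrightarrow> c \<le> E_lam X t \<mu> lam x"
      by (meson Suc_leD)
    define k where "k = T - Suc t"
    have k: "k < T" "t = T - Suc k" "T - t = Suc k" using Suc.prems by (auto simp: k_def)
    obtain l where l: "l \<in> borel_measurable (XT X t)" "\<And>x. l x \<in> {1 / (\<mu> - 1)..1 / \<mu>}"
      "\<And>x y c. x \<in> paths t \<Longrightarrow> y \<in> X \<Longrightarrow> (x(t := y), c) \<in> attainable T E k \<Longrightarrow>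
        c \<le> E_lam X t \<mu> lam x * (1 + l x * (y - \<mu>))"
      using exists_bet[OF E_meas E_nonneg k(1,2) E_lam_measurable[OF lam(1)] E_lam_nonneg[OF lam(1)]]
        lam(2) k(3) by metis
    let ?lam = "lam(t := l)"
    have "?lam \<in> Lambda_mu X (Suc t) \<mu>"
      using lam(1) l(1,2) by (auto simp: Lambda_mu_def less_Suc_eq)
    moreover have "c \<le> E_lam X (Suc t) \<mu> ?lam x" if x: "x \<in> paths (Suc t)" and c: "(x, c) \<in> attainable T E k" for x c
    proof -
      obtain x' y where x': "x' \<in> paths t" "y \<in> X" "x = x'(t := y)" using x path_Suc_cases by blast
      have "E_lam X t \<mu> ?lam = E_lam X t \<mu> lam" by (rule E_lam_cong) simp
      then show ?thesis using l(3)[OF x'(1,2)] c E_lam_upd[OF x'(1,2), of ?lam] x'(3)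
        by (simp del: fun_upd_apply add: fun_upd_same)
    qed
    ultimately show ?case unfolding k_def by blast
  qed
  from this[of T] obtain lam where lam: "lam \<in> Lambda_mu X T \<mu>"
    "\<And>x c. x \<in> paths T \<Longrightarrow> (x, c) \<in> attainable T E 0 \<Longrightarrow> c \<le> E_lam X T \<mu> lam x" by auto
  \<comment> \<open>With no steps left, \<open>E x\<close> itself is attainable at
    \<open>x\<close>.\<close>
  then show ?thesis using E_nonneg by (intro bexI[of _ lam]) auto
qed

lemma majorising_E_cb: "majorising (XT X T) (H_mu X T \<mu>) (E_cb X T \<mu>)"
  unfolding majorising_def e_class_def E_cb_def using E_lam_evar E_lam_majorises by blast

text \<open>A member \<open>F\<close> lies below some \<open>E\<close> in \<open>C\<close>, which
  lies below another member of the class. Maximality makes all three equal on paths; elsewhere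
  \<open>F\<close> and \<open>E\<close> are 0 by normalisation, so they are the same
  function.\<close>

lemma E_cb_subset_majorising:
  assumes "majorising (XT X T) (H_mu X T \<mu>) C"
  shows "E_cb X T \<mu> \<subseteq> C"
proof
  fix F assume "F \<in> E_cb X T \<mu>"
  then obtain lam where lam: "lam \<in> Lambda_mu X T \<mu>" "F = E_lam X T \<mu> lam" by (auto simp: E_cb_def)
  obtain E where E: "E \<in> C" "\<And>x. x \<in> paths T \<Longrightarrow> F x \<le> E x" "E \<in> evars (XT X T) (H_mu X T \<mu>)"
    using assms E_lam_evar[OF lam(1)] unfolding majorising_def e_class_def lam(2) by blast
  obtain lam' where lam': "lam' \<in> Lambda_mu X T \<mu>" "\<And>x. x \<in> paths T \<Longrightarrow> E x \<le> E_lam X T \<mu> lam' x"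
    using E_lam_majorises[OF E(3)] by blast
  have "F x = E x" for x
  proof (cases "x \<in> paths T")
    case True
    have "F x = E_lam X T \<mu> lam' x" unfolding lam(2)
      by (rule E_lam_maximal[OF lam(1) lam'(1) _ True]) (use E(2) lam'(2) lam(2) in fastforce)
    then show ?thesis using E(2)[OF True] lam'(2)[OF True] by simp
  next
    case False
    then show ?thesis using E(3) by (simp add: lam(2) E_lam_def evars_def)
  qed
  then show "F \<in> C" using E(1) by (metis ext)
qed

end

theorem theorem2:
  fixes X :: "real set" and T :: nat and \<mu> :: real
  assumes "X \<in> sets borel" and "X \<subseteq> {0..1}" and "0 \<in> X" and "1 \<in> X"
    and "T \<ge> 1" and "0 < \<mu>" and "\<mu> < 1"
  shows "optimal_eclass (XT X T) (H_mu X T \<mu>) (E_cb X T \<mu>)"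
proof -
  interpret bounded_mean X \<mu> using assms by unfold_locales auto
  show ?thesis unfolding optimal_eclass_def using majorising_E_cb E_cb_subset_majorising by blast
qed

end
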